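(* Let $(M,P,g)$ be a Riemannian almost product $\mathcal{W}_3$-manifold with canonical connection $\nabla'$, torsion $T$ of $\nabla'$ and curvature tensor $R'$ of $\nabla'$. If $R'$ is a Riemannian $P$-tensor, then \[ T(T(x,y),z,w)=0 \] for all $x,y,z,w$.
   Context: A Riemannian almost product manifold $(M,P,g)$ is a differentiable manifold $M$ with a $(1,1)$-tensor field $P$ and a Riemannian metric $g$ such that $P^2x=x$ and $g(Px,Py)=g(x,y)$ for all vector fields $x,y$; throughout it is assumed that $\mathrm{tr}\,P=0$. Let $\nabla$ be the Levi-Civita connection of $g$ and $F(x,y,z)=g((\nabla_xP)y,z)$. $(M,P,g)$ is a Riemannian almost product $\mathcal{W}_3$-manifold if $F(x,y,z)+F(y,z,x)+F(z,x,y)=0$ for all $x,y,z$. A natural connection is a linear connection $\nabla'$ with $\nabla'P=0$ and $\nabla'g=0$; its torsion is $T(x,y)=\nabla'_xy-\nabla'_yx-[x,y]$, with $T(x,y,z)=g(T(x,y),z)$. The canonical connection is the natural connection whose torsion satisfies \[T(x,y,z)+T(y,z,x)+T(Px,y,Pz)+T(y,Pz,Px)=0\] for all $x,y,z$; it is known that it exists and is unique on every Riemannian almost product manifold. The curvature tensor of $\nabla'$ is $R'(x,y)z=\nabla'_x\nabla'_yz-\nabla'_y\nabla'_xz-\nabla'_{[x,y]}z$, $R'(x,y,z,w)=g(R'(x,y)z,w)$. A $(0,4)$-tensor $L$ is called a Riemannian $P$-tensor if for all $x,y,z,w$: $L(x,y,z,w)=-L(y,x,z,w)=-L(x,y,w,z)$;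 $L(x,y,z,w)+L(y,z,x,w)+L(z,x,y,w)=0$; and $L(x,y,Pz,Pw)=L(x,y,z,w)$. *)

theory Defs
  imports "HOL-Analysis.Analysis" "HOL-Library.Function_Algebras"
begin

(* Sums, differences and products of functions (hence of scalar functions, tangent vectors and
   vector fields) are the pointwise ones of Function_Algebras. *)

section \<open>Smooth manifolds\<close>

(* Meant for open S; the domain is finite-dimensional, so continuity of all directional
   derivatives is continuity of the derivative. *)
primrec Ck_on :: "nat \<Rightarrow> 'e::euclidean_space set \<Rightarrow> ('e \<Rightarrow> 'b::real_normed_vector) \<Rightarrow> bool" where
  "Ck_on 0 S f \<longleftrightarrow> continuous_on S f"
| "Ck_on (Suc k) S f \<longleftrightarrow>
     (\<forall>u\<in>S. f differentiable (at u)) \<and> (\<forall>d. Ck_on k S (\<lambda>u. frechet_derivative f (at u) d))"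

definition smooth_on :: "'e::euclidean_space set \<Rightarrow> ('e \<Rightarrow> 'b::real_normed_vector) \<Rightarrow> bool" where
  "smooth_on S f \<longleftrightarrow> (\<forall>k. Ck_on k S f)"

(* A chart is a pair (U, \<phi>); the values of \<phi> outside U are irrelevant. *)
type_synonym ('a, 'e) atlas = "('a set \<times> ('a \<Rightarrow> 'e)) set"

(* The manifold is the whole (Hausdorff, second countable) type 'a, modelled on 'e.
   The atlas need not be maximal. *)
definition smooth_atlas ::
  "('a::{t2_space, second_countable_topology}, 'e::euclidean_space) atlas \<Rightarrow> bool" where
  "smooth_atlas A \<longleftrightarrow>
     (\<Union>(U, \<phi>)\<in>A. U) = UNIV \<and>
     (\<forall>(U, \<phi>)\<in>A. open U \<and> open (\<phi> ` U) \<and> homeomorphism U (\<phi> ` U) \<phi> (inv_into U \<phi>)) \<and>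
     (\<forall>(U, \<phi>)\<in>A. \<forall>(V, \<psi>)\<in>A. smooth_on (\<phi> ` (U \<inter> V)) (\<psi> \<circ> inv_into U \<phi>))"

definition smooth_functions :: "('a, 'e::euclidean_space) atlas \<Rightarrow> ('a \<Rightarrow> real) set" where
  "smooth_functions A = {f. \<forall>(U, \<phi>)\<in>A. smooth_on (\<phi> ` U) (f \<circ> inv_into U \<phi>)}"


section \<open>Tangent vectors and vector fields\<close>

type_synonym 'a tangent = "('a \<Rightarrow> real) \<Rightarrow> real"
type_synonym 'a vfield = "'a \<Rightarrow> 'a tangent"

definition scale_tangent :: "real \<Rightarrow> 'a tangent \<Rightarrow> 'a tangent" where
  "scale_tangent c v = (\<lambda>f. c * v f)"

global_interpretation tangent: vector_space scale_tangent
  by unfold_locales (auto simp: scale_tangent_def fun_eq_iff algebra_simps)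

(* Derivations at p of the algebra of smooth functions; the last clause makes a derivation
   a unique HOL function. *)
definition tangent_space :: "('a, 'e::euclidean_space) atlas \<Rightarrow> 'a \<Rightarrow> 'a tangent set" where
  "tangent_space A p = {v.
     (\<forall>f\<in>smooth_functions A. \<forall>h\<in>smooth_functions A. v (f + h) = v f + v h) \<and>
     (\<forall>f\<in>smooth_functions A. \<forall>c. v (\<lambda>q. c * f q) = c * v f) \<and>
     (\<forall>f\<in>smooth_functions A. \<forall>h\<in>smooth_functions A. v (f * h) = f p * v h + h p * v f) \<and>
     (\<forall>f. f \<notin> smooth_functions A \<longrightarrow> v f = 0)}"

definition vf_deriv :: "'a vfield \<Rightarrow> ('a \<Rightarrow> real) \<Rightarrow> ('a \<Rightarrow> real)" where
  "vf_deriv x f = (\<lambda>p. x p f)"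

definition vector_fields :: "('a, 'e::euclidean_space) atlas \<Rightarrow> 'a vfield set" where
  "vector_fields A = {x. (\<forall>p. x p \<in> tangent_space A p) \<and>
     (\<forall>f\<in>smooth_functions A. vf_deriv x f \<in> smooth_functions A)}"

definition vf_scale :: "('a \<Rightarrow> real) \<Rightarrow> 'a vfield \<Rightarrow> 'a vfield" where
  "vf_scale f x = (\<lambda>p. scale_tangent (f p) (x p))"

definition lie_bracket :: "'a vfield \<Rightarrow> 'a vfield \<Rightarrow> 'a vfield" where
  "lie_bracket x y = (\<lambda>p f. x p (vf_deriv y f) - y p (vf_deriv x f))"


section \<open>Riemannian almost product manifolds\<close>

type_synonym 'a endo_field = "'a \<Rightarrow> 'a tangent \<Rightarrow> 'a tangent"
type_synonym 'a bilin_field = "'a \<Rightarrow> 'a tangent \<Rightarrow> 'a tangent \<Rightarrow> real"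

definition endo :: "'a endo_field \<Rightarrow> 'a vfield \<Rightarrow> 'a vfield" where
  "endo P x = (\<lambda>p. P p (x p))"

definition inner_vf :: "'a bilin_field \<Rightarrow> 'a vfield \<Rightarrow> 'a vfield \<Rightarrow> ('a \<Rightarrow> real)" where
  "inner_vf g x y = (\<lambda>p. g p (x p) (y p))"

definition tensor_field_11 :: "('a, 'e::euclidean_space) atlas \<Rightarrow> 'a endo_field \<Rightarrow> bool" where
  "tensor_field_11 A P \<longleftrightarrow>
     (\<forall>p. \<forall>u\<in>tangent_space A p. P p u \<in> tangent_space A p \<and>
        (\<forall>v\<in>tangent_space A p. P p (u + v) = P p u + P p v) \<and>
        (\<forall>c. P p (scale_tangent c u) = scale_tangent c (P p u))) \<and>
     (\<forall>x\<in>vector_fields A. endo P x \<in> vector_fields A)"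

definition riemannian_metric :: "('a, 'e::euclidean_space) atlas \<Rightarrow> 'a bilin_field \<Rightarrow> bool" where
  "riemannian_metric A g \<longleftrightarrow>
     (\<forall>p. \<forall>u\<in>tangent_space A p.
        (\<forall>v\<in>tangent_space A p. g p u v = g p v u) \<and>
        (\<forall>v\<in>tangent_space A p. \<forall>w\<in>tangent_space A p. g p (u + v) w = g p u w + g p v w) \<and>
        (\<forall>v\<in>tangent_space A p. \<forall>c. g p (scale_tangent c u) v = c * g p u v) \<and>
        (u \<noteq> 0 \<longrightarrow> g p u u > 0)) \<and>
     (\<forall>x\<in>vector_fields A. \<forall>y\<in>vector_fields A. inner_vf g x y \<in> smooth_functions A)"

(* Trace of an endomorphism L of the tangent space at p: the sum of the diagonal matrix entries
   with respect to a basis (the choice of basis is immaterial). *)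
definition tangent_trace ::
  "('a, 'e::euclidean_space) atlas \<Rightarrow> 'a \<Rightarrow> ('a tangent \<Rightarrow> 'a tangent) \<Rightarrow> real" where
  "tangent_trace A p L =
     (let B = (SOME B. tangent.independent B \<and> tangent.span B = tangent_space A p)
      in \<Sum>b\<in>B. tangent.representation B (L b) b)"

definition riemannian_almost_product_manifold ::
  "('a::{t2_space, second_countable_topology}, 'e::euclidean_space) atlas
     \<Rightarrow> 'a endo_field \<Rightarrow> 'a bilin_field \<Rightarrow> bool" where
  "riemannian_almost_product_manifold A P g \<longleftrightarrow>
     smooth_atlas A \<and> tensor_field_11 A P \<and> riemannian_metric A g \<and>
     (\<forall>x\<in>vector_fields A. endo P (endo P x) = x) \<and>
     (\<forall>x\<in>vector_fields A. \<forall>y\<in>vector_fields A.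
        inner_vf g (endo P x) (endo P y) = inner_vf g x y) \<and>
     (\<forall>p. tangent_trace A p (P p) = 0)"


section \<open>Connections\<close>

type_synonym 'a connection = "'a vfield \<Rightarrow> 'a vfield \<Rightarrow> 'a vfield"

definition linear_connection :: "('a, 'e::euclidean_space) atlas \<Rightarrow> 'a connection \<Rightarrow> bool" where
  "linear_connection A D \<longleftrightarrow>
     (\<forall>x\<in>vector_fields A. \<forall>y\<in>vector_fields A. D x y \<in> vector_fields A \<and>
        (\<forall>z\<in>vector_fields A. D (x + y) z = D x z + D y z) \<and>
        (\<forall>z\<in>vector_fields A. D x (y + z) = D x y + D x z) \<and>
        (\<forall>f\<in>smooth_functions A. D (vf_scale f x) y = vf_scale f (D x y)) \<and>
        (\<forall>f\<in>smooth_functions A.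
           D x (vf_scale f y) = vf_scale (vf_deriv x f) y + vf_scale f (D x y)))"

definition torsion :: "'a connection \<Rightarrow> 'a vfield \<Rightarrow> 'a vfield \<Rightarrow> 'a vfield" where
  "torsion D x y = D x y - D y x - lie_bracket x y"

definition torsion3 ::
  "'a bilin_field \<Rightarrow> 'a connection \<Rightarrow> 'a vfield \<Rightarrow> 'a vfield \<Rightarrow> 'a vfield \<Rightarrow> ('a \<Rightarrow> real)" where
  "torsion3 g D x y z = inner_vf g (torsion D x y) z"

definition curvature :: "'a connection \<Rightarrow> 'a vfield \<Rightarrow> 'a vfield \<Rightarrow> 'a vfield \<Rightarrow> 'a vfield" where
  "curvature D x y z = D x (D y z) - D y (D x z) - D (lie_bracket x y) z"

definition curvature4 ::
  "'a bilin_field \<Rightarrow> 'a connection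
     \<Rightarrow> 'a vfield \<Rightarrow> 'a vfield \<Rightarrow> 'a vfield \<Rightarrow> 'a vfield \<Rightarrow> ('a \<Rightarrow> real)" where
  "curvature4 g D x y z w = inner_vf g (curvature D x y z) w"

(* (D_x P) y *)
definition deriv_endo ::
  "'a connection \<Rightarrow> 'a endo_field \<Rightarrow> 'a vfield \<Rightarrow> 'a vfield \<Rightarrow> 'a vfield" where
  "deriv_endo D P x y = D x (endo P y) - endo P (D x y)"

(* (D_x g)(y, z) *)
definition deriv_metric ::
  "'a connection \<Rightarrow> 'a bilin_field \<Rightarrow> 'a vfield \<Rightarrow> 'a vfield \<Rightarrow> 'a vfield \<Rightarrow> ('a \<Rightarrow> real)" where
  "deriv_metric D g x y z =
     vf_deriv x (inner_vf g y z) - inner_vf g (D x y) z - inner_vf g y (D x z)"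

definition levi_civita_connection ::
  "('a, 'e::euclidean_space) atlas \<Rightarrow> 'a bilin_field \<Rightarrow> 'a connection \<Rightarrow> bool" where
  "levi_civita_connection A g D \<longleftrightarrow> linear_connection A D \<and>
     (\<forall>x\<in>vector_fields A. \<forall>y\<in>vector_fields A. torsion D x y = 0) \<and>
     (\<forall>x\<in>vector_fields A. \<forall>y\<in>vector_fields A. \<forall>z\<in>vector_fields A. deriv_metric D g x y z = 0)"

definition natural_connection ::
  "('a, 'e::euclidean_space) atlas \<Rightarrow> 'a endo_field \<Rightarrow> 'a bilin_field \<Rightarrow> 'a connection \<Rightarrow> bool" where
  "natural_connection A P g D \<longleftrightarrow> linear_connection A D \<and>
     (\<forall>x\<in>vector_fields A. \<forall>y\<in>vector_fields A. deriv_endo D P x y = 0) \<and>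
     (\<forall>x\<in>vector_fields A. \<forall>y\<in>vector_fields A. \<forall>z\<in>vector_fields A. deriv_metric D g x y z = 0)"

definition canonical_connection ::
  "('a, 'e::euclidean_space) atlas \<Rightarrow> 'a endo_field \<Rightarrow> 'a bilin_field \<Rightarrow> 'a connection \<Rightarrow> bool" where
  "canonical_connection A P g D \<longleftrightarrow> natural_connection A P g D \<and>
     (\<forall>x\<in>vector_fields A. \<forall>y\<in>vector_fields A. \<forall>z\<in>vector_fields A.
        torsion3 g D x y z + torsion3 g D y z x
        + torsion3 g D (endo P x) y (endo P z) + torsion3 g D y (endo P z) (endo P x) = 0)"


section \<open>The class \<open>W\<^sub>3\<close> and Riemannian P-tensors\<close>

definition F_tensor ::
  "'a endo_field \<Rightarrow> 'a bilin_field \<Rightarrow> 'a connection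
     \<Rightarrow> 'a vfield \<Rightarrow> 'a vfield \<Rightarrow> 'a vfield \<Rightarrow> ('a \<Rightarrow> real)" where
  "F_tensor P g D x y z = inner_vf g (deriv_endo D P x y) z"

(* The parameter D is the Levi-Civita connection of g (which exists and is unique). *)
definition W3_manifold ::
  "('a::{t2_space, second_countable_topology}, 'e::euclidean_space) atlas
     \<Rightarrow> 'a endo_field \<Rightarrow> 'a bilin_field \<Rightarrow> 'a connection \<Rightarrow> bool" where
  "W3_manifold A P g D \<longleftrightarrow>
     riemannian_almost_product_manifold A P g \<and> levi_civita_connection A g D \<and>
     (\<forall>x\<in>vector_fields A. \<forall>y\<in>vector_fields A. \<forall>z\<in>vector_fields A.
        F_tensor P g D x y z + F_tensor P g D y z x + F_tensor P g D z x y = 0)"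

(* Only the identities: that L is a (0,4)-tensor is left to the context
   (for a curvature tensor it is automatic). *)
definition riemannian_P_tensor ::
  "('a, 'e::euclidean_space) atlas \<Rightarrow> 'a endo_field
     \<Rightarrow> ('a vfield \<Rightarrow> 'a vfield \<Rightarrow> 'a vfield \<Rightarrow> 'a vfield \<Rightarrow> ('a \<Rightarrow> real)) \<Rightarrow> bool" where
  "riemannian_P_tensor A P L \<longleftrightarrow>
     (\<forall>x\<in>vector_fields A. \<forall>y\<in>vector_fields A. \<forall>z\<in>vector_fields A. \<forall>w\<in>vector_fields A.
        L x y z w = - L y x z w \<and>
        L x y z w = - L x y w z \<and>
        L x y z w + L y z x w + L z x y w = 0 \<and>
        L x y (endo P z) (endo P w) = L x y z w)"

end

theory Submission
  imports Defs
begin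

text \<open>
  The tangent bundle splits orthogonally into the eigenbundles \<open>H\<close> (\<open>P = 1\<close>) and \<open>V\<close> (\<open>P = -1\<close>), and
  \<open>\<nabla>'\<close> preserves both. The condition defining the canonical connection says that
  \<open>T(a,c,b) = T(b,c,a)\<close> whenever \<open>a\<close> and \<open>b\<close> lie in the same eigenbundle, for every \<open>c\<close>. Together with
  the skew symmetry of \<open>T\<close> this kills \<open>T(a,b,c)\<close> for \<open>a\<close>, \<open>b\<close>, \<open>c\<close> all in one eigenbundle
  (\<open>T_same_eigen_opposite\<close>). The class \<open>W\<^sub>3\<close> is the requirement that \<open>\<nabla>\<^sub>a b + \<nabla>\<^sub>b a\<close> has no
  component in the opposite eigenbundle (\<open>nabla_eigen_antisymmetric\<close>); it turns the symmetric
  form \<open>T(a,c,b)\<close>, with \<open>c\<close> in the opposite eigenbundle, into a skew one. Hence the torsion maps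
  \<open>H \<times> H\<close> into \<open>V\<close> and \<open>V \<times> V\<close> into \<open>H\<close>, and it vanishes on mixed pairs (\<open>T_mixed_eigen_zero\<close>).

  By \<open>first_bianchi\<close>, the cyclic identity for the curvature becomes an identity for \<open>T\<close> and its
  derivatives. Evaluated at \<open>a\<close>, \<open>b\<close> in one eigenbundle and \<open>c\<close> in the other one, all its terms lie in
  the eigenbundle of \<open>c\<close>, except for \<open>T(T(a,b),c)\<close>, which lies in the eigenbundle of \<open>a\<close> and \<open>b\<close>. So
  \<open>T(T(a,b),c) = 0\<close> (\<open>torsion_of_torsion_eigen\<close>). For all other combinations of types the same
  vanishing is immediate from the type of \<open>T\<close>.

  The argument runs on global vector fields by additivity alone, since twice any vector field is
  the sum of two global eigenfields.
\<close>

section \<open>The additive group of vector fields\<close>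

text \<open>The definition differentiates a function at the points of \<open>S\<close> as a function on the whole space, so
  openness of \<open>S\<close> is what makes the values on \<open>S\<close> decisive.\<close>

lemma Ck_on_cong:
  assumes "open S" "\<And>u. u \<in> S \<Longrightarrow> f u = h u" "Ck_on k S f"
  shows "Ck_on k S h"
  using assms(2,3)
proof (induction k arbitrary: f h)
  case 0
  then show ?case by (simp cong: continuous_on_cong)
next
  case (Suc k)
  have der: "(f has_derivative D) (at u) \<Longrightarrow> (h has_derivative D) (at u)" if "u \<in> S" for u D
    using has_derivative_transform_within_open[OF _ assms(1) that] Suc.prems(1) by metis
  have diff: "f differentiable (at u)" if "u \<in> S" for u
    using Suc.prems(2) that by simp
  have eq: "frechet_derivative f (at u) = frechet_derivative h (at u)" if "u \<in> S" for u
    using frechet_derivative_at[OF der[OF that]] diff[OF that] frechet_derivative_works by blast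
  have "h differentiable (at u)" if "u \<in> S" for u
    using der[OF that] diff[OF that] unfolding differentiable_def by blast
  moreover have "Ck_on k S (\<lambda>u. frechet_derivative h (at u) d)" for d
    using Suc.IH[of "\<lambda>u. frechet_derivative f (at u) d"] eq Suc.prems(2) by simp
  ultimately show ?case by simp
qed

lemma Ck_on_diff:
  assumes "open S" "Ck_on k S f" "Ck_on k S h"
  shows "Ck_on k S (\<lambda>u. f u - h u)"
  using assms(2,3)
proof (induction k arbitrary: f h)
  case 0
  then show ?case by (simp add: continuous_on_diff)
next
  case (Suc k)
  have "Ck_on k S (\<lambda>u. frechet_derivative (\<lambda>u. f u - h u) (at u) d)" for d
  proof (rule Ck_on_cong[OF assms(1)])
    show "Ck_on k S (\<lambda>u. frechet_derivative f (at u) d - frechet_derivative h (at u) d)"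
      using Suc by simp
  next
    fix u assume "u \<in> S"
    then have "f differentiable (at u)" "h differentiable (at u)"
      using Suc.prems by auto
    then have "((\<lambda>u. f u - h u) has_derivative
        (\<lambda>d. frechet_derivative f (at u) d - frechet_derivative h (at u) d)) (at u)"
      by (intro has_derivative_diff) (simp_all add: frechet_derivative_works[symmetric])
    then show "frechet_derivative f (at u) d - frechet_derivative h (at u) d
        = frechet_derivative (\<lambda>u. f u - h u) (at u) d"
      by (metis frechet_derivative_at)
  qed
  then show ?case using Suc.prems by (auto intro: differentiable_diff)
qed

lemma smooth_functions_diff:
  assumes "smooth_atlas A" "f \<in> smooth_functions A" "h \<in> smooth_functions A"
  shows "f - h \<in> smooth_functions A"
proof -
  have "smooth_on (\<phi> ` U) ((f - h) \<circ> inv_into U \<phi>)" if "(U, \<phi>) \<in> A" for U \<phi>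
  proof -
    have "open (\<phi> ` U)"
      using assms(1) that by (auto simp: smooth_atlas_def)
    moreover have "smooth_on (\<phi> ` U) (f \<circ> inv_into U \<phi>)" "smooth_on (\<phi> ` U) (h \<circ> inv_into U \<phi>)"
      using assms(2,3) that by (auto simp: smooth_functions_def)
    ultimately show ?thesis
      using Ck_on_diff unfolding smooth_on_def comp_def fun_diff_def by blast
  qed
  then show ?thesis by (auto simp: smooth_functions_def)
qed

text \<open>Tangent vectors, the metric, \<open>P\<close>, connections and torsion behave additively only on smooth functions
  or on genuine vector fields, which are subgroups of full function types. The locale provides the
  usual consequences of additivity for all of them.\<close>

locale subgroup_additive =
  fixes S :: "'v::ab_group_add set" and f :: "'v \<Rightarrow> 'w::ab_group_add"
  assumes diff_closed: "x \<in> S \<Longrightarrow> y \<in> S \<Longrightarrow> x - y \<in> S"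
    and add: "x \<in> S \<Longrightarrow> y \<in> S \<Longrightarrow> f (x + y) = f x + f y"
begin

lemma diff: "x \<in> S \<Longrightarrow> y \<in> S \<Longrightarrow> f (x - y) = f x - f y"
  using add[of "x - y" y] diff_closed by (simp add: algebra_simps)

lemma zero: "x \<in> S \<Longrightarrow> f 0 = 0"
  using diff[of x x] by simp

lemma minus: "x \<in> S \<Longrightarrow> f (- x) = - f x"
  using diff[of 0 x] zero diff_closed[of x x] by simp

end

lemma tangent_diff:
  assumes "smooth_atlas A" "v \<in> tangent_space A p" "f \<in> smooth_functions A" "h \<in> smooth_functions A"
  shows "v (f - h) = v f - v h"
proof -
  interpret subgroup_additive "smooth_functions A" v
    using assms by unfold_locales (auto simp: tangent_space_def smooth_functions_diff)
  show ?thesis using assms diff by simp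
qed

lemma tangent_zero_function:
  assumes "v \<in> tangent_space A p"
  shows "v (\<lambda>q. 0) = 0"
proof (cases "(\<lambda>q. 0) \<in> smooth_functions A")
  case True
  have "\<forall>f\<in>smooth_functions A. \<forall>c. v (\<lambda>q. c * f q) = c * v f"
    using assms by (simp add: tangent_space_def)
  from bspec[OF this True] have "v (\<lambda>q. 0 * 0) = 0 * v (\<lambda>q. 0)" by (rule spec)
  then show ?thesis by simp
next
  case False
  then show ?thesis using assms by (simp add: tangent_space_def)
qed

lemma tangent_space_diff:
  "u \<in> tangent_space A p \<Longrightarrow> v \<in> tangent_space A p \<Longrightarrow> u - v \<in> tangent_space A p"
  by (auto simp: tangent_space_def algebra_simps)

lemma tangent_space_zero: "0 \<in> tangent_space A p"
  by (auto simp: tangent_space_def)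

lemma vector_field_at: "x \<in> vector_fields A \<Longrightarrow> x p \<in> tangent_space A p"
  by (simp add: vector_fields_def)

lemma vector_fields_diff:
  assumes "smooth_atlas A" "x \<in> vector_fields A" "y \<in> vector_fields A"
  shows "x - y \<in> vector_fields A"
proof -
  have "vf_deriv (x - y) f = vf_deriv x f - vf_deriv y f" for f
    by (simp add: vf_deriv_def fun_eq_iff)
  then show ?thesis
    using assms by (auto simp: vector_fields_def tangent_space_diff smooth_functions_diff)
qed

lemma lie_bracket_swap: "lie_bracket y x = - lie_bracket x y"
  by (simp add: lie_bracket_def fun_eq_iff)

text \<open>The usual cancellation of second derivatives holds where \<open>f\<close> is smooth. At other functions
  tangent vectors have the default value \<open>0\<close>, and this case is needed because the identity is one
  between functions on all of \<open>'a \<Rightarrow> real\<close>.\<close>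

lemma lie_bracket_jacobi:
  assumes A: "smooth_atlas A"
    and "x \<in> vector_fields A" "y \<in> vector_fields A" "z \<in> vector_fields A"
  shows "lie_bracket x (lie_bracket y z) + lie_bracket y (lie_bracket z x)
           + lie_bracket z (lie_bracket x y) = 0"
proof (intro ext)
  have deriv: "vf_deriv v f \<in> smooth_functions A"
    if "v \<in> vector_fields A" "f \<in> smooth_functions A" for v f
    using that by (simp add: vector_fields_def)
  have bracket: "vf_deriv (lie_bracket u v) f = vf_deriv u (vf_deriv v f) - vf_deriv v (vf_deriv u f)" for u v f
    by (simp add: vf_deriv_def lie_bracket_def fun_eq_iff)
  fix p f
  show "(lie_bracket x (lie_bracket y z) + lie_bracket y (lie_bracket z x)
           + lie_bracket z (lie_bracket x y)) p f = 0 p f"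
  proof (cases "f \<in> smooth_functions A")
    case True
    then show ?thesis
      using assms
      by (simp add: lie_bracket_def[of _ "lie_bracket _ _"] bracket deriv
            tangent_diff[OF A vector_field_at])
         (simp add: lie_bracket_def vf_deriv_def)
  next
    case False
    then have zero: "vf_deriv v f = (\<lambda>q. 0)" if "v \<in> vector_fields A" for v
      using vector_field_at[OF that] by (auto simp: vf_deriv_def tangent_space_def fun_eq_iff)
    have zero': "vf_deriv v (\<lambda>q. 0) = (\<lambda>q. 0)" "v p (\<lambda>q. 0) = 0" if "v \<in> vector_fields A" for v
      using tangent_zero_function[OF vector_field_at[OF that]] by (simp_all add: vf_deriv_def)
    have zero'': "vf_deriv (lie_bracket u v) f = (\<lambda>q. 0)" if "u \<in> vector_fields A" "v \<in> vector_fields A" for u v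
      using that by (simp add: bracket zero zero' fun_eq_iff)
    have "lie_bracket u (lie_bracket v w) p f = 0"
      if "u \<in> vector_fields A" "v \<in> vector_fields A" "w \<in> vector_fields A" for u v w
      using that zero''[OF that(2,3)]
      by (simp add: lie_bracket_def[of u] zero zero' lie_bracket_def[of v w])
    then show ?thesis using assms by simp
  qed
qed

lemma fun_self_neg_zero: "X = 0" if "X = - X" for X :: "'a \<Rightarrow> real"
proof
  show "X p = 0 p" for p
    using fun_cong[OF that, of p] by simp
qed

lemma vfield_self_neg_zero: "X = 0" if "X = - X" for X :: "'a vfield"
proof
  fix p
  have "X p = - X p"
    using fun_cong[OF that, of p] unfolding uminus_apply .
  then have "X p = 0" by (rule fun_self_neg_zero)
  then show "X p = 0 p" by simp
qed


section \<open>Eigenfields of the product structure\<close>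

text \<open>Here \<open>D\<close> is the canonical connection. Its curvature is unrestricted, so that the facts on the
  types of the torsion and the Bianchi identity hold on every \<open>W\<^sub>3\<close>-manifold.\<close>

locale canonical_W3 =
  fixes A :: "('a::{t2_space, second_countable_topology}, 'e::euclidean_space) atlas"
    and P :: "'a endo_field"
    and g :: "'a bilin_field"
    and nabla D :: "'a connection"
  assumes W3: "W3_manifold A P g nabla"
    and canonical: "canonical_connection A P g D"
begin

abbreviation VF where "VF \<equiv> vector_fields A"
abbreviation T where "T \<equiv> torsion D"
abbreviation G where "G \<equiv> inner_vf g"

lemma atlas: "smooth_atlas A"
  and tensor_P: "tensor_field_11 A P"
  and metric: "riemannian_metric A g"
  and PP: "x \<in> VF \<Longrightarrow> endo P (endo P x) = x"
  and GP: "x \<in> VF \<Longrightarrow> y \<in> VF \<Longrightarrow> G (endo P x) (endo P y) = G x y"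
  and lc_nabla: "linear_connection A nabla"
  and nabla_torsion: "x \<in> VF \<Longrightarrow> y \<in> VF \<Longrightarrow> torsion nabla x y = 0"
  and nabla_metric: "x \<in> VF \<Longrightarrow> y \<in> VF \<Longrightarrow> z \<in> VF \<Longrightarrow> deriv_metric nabla g x y z = 0"
  and F_cyclic: "x \<in> VF \<Longrightarrow> y \<in> VF \<Longrightarrow> z \<in> VF \<Longrightarrow>
        F_tensor P g nabla x y z + F_tensor P g nabla y z x + F_tensor P g nabla z x y = 0"
  using W3
  unfolding W3_manifold_def riemannian_almost_product_manifold_def levi_civita_connection_def
  by blast+

lemma lc_D: "linear_connection A D"
  and D_P: "x \<in> VF \<Longrightarrow> y \<in> VF \<Longrightarrow> D x (endo P y) = endo P (D x y)"
  and D_metric: "x \<in> VF \<Longrightarrow> y \<in> VF \<Longrightarrow> z \<in> VF \<Longrightarrow> deriv_metric D g x y z = 0"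
  and T_canonical: "x \<in> VF \<Longrightarrow> y \<in> VF \<Longrightarrow> z \<in> VF \<Longrightarrow>
        G (T x y) z + G (T y z) x + G (T (endo P x) y) (endo P z) + G (T y (endo P z)) (endo P x) = 0"
  using canonical
  unfolding canonical_connection_def natural_connection_def deriv_endo_def torsion3_def
    right_minus_eq
  by blast+

lemma VF_diff: "x \<in> VF \<Longrightarrow> y \<in> VF \<Longrightarrow> x - y \<in> VF"
  using vector_fields_diff[OF atlas] .

lemma VF_zero: "0 \<in> VF"
proof -
  have "vf_deriv 0 f = f - f" for f :: "'a \<Rightarrow> real"
    by (simp add: vf_deriv_def fun_eq_iff)
  then have "vf_deriv 0 f \<in> smooth_functions A" if "f \<in> smooth_functions A" for f
    using smooth_functions_diff[OF atlas that that] by metis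
  then show ?thesis
    by (simp add: vector_fields_def tangent_space_zero)
qed

lemma VF_minus: "x \<in> VF \<Longrightarrow> - x \<in> VF"
  using VF_diff[OF VF_zero, of x] by simp

lemma VF_add: "x \<in> VF \<Longrightarrow> y \<in> VF \<Longrightarrow> x + y \<in> VF"
  using VF_diff[OF _ VF_minus, of x y] by simp

lemma endo_VF: "x \<in> VF \<Longrightarrow> endo P x \<in> VF"
  using tensor_P by (simp add: tensor_field_11_def)

lemma D_VF: "x \<in> VF \<Longrightarrow> y \<in> VF \<Longrightarrow> D x y \<in> VF"
  and nabla_VF: "x \<in> VF \<Longrightarrow> y \<in> VF \<Longrightarrow> nabla x y \<in> VF"
  using lc_D lc_nabla by (auto simp: linear_connection_def)

lemma lie_bracket_nabla: "x \<in> VF \<Longrightarrow> y \<in> VF \<Longrightarrow> lie_bracket x y = nabla x y - nabla y x"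
  using nabla_torsion[of x y] by (simp add: torsion_def)

text \<open>As the Levi-Civita connection is free of torsion, the bracket is a difference of covariant
  derivatives, and closure under brackets follows from closure under differences.\<close>

lemma lie_bracket_VF: "x \<in> VF \<Longrightarrow> y \<in> VF \<Longrightarrow> lie_bracket x y \<in> VF"
  by (simp add: lie_bracket_nabla VF_diff nabla_VF)

lemma T_VF: "x \<in> VF \<Longrightarrow> y \<in> VF \<Longrightarrow> T x y \<in> VF"
  by (simp add: torsion_def VF_diff D_VF lie_bracket_VF)

lemma T_swap: "T y x = - T x y"
  by (simp add: torsion_def lie_bracket_swap[of x y])

lemma G_sym: "x \<in> VF \<Longrightarrow> y \<in> VF \<Longrightarrow> G x y = G y x"
  using metric by (simp add: riemannian_metric_def inner_vf_def fun_eq_iff vector_field_at)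

lemma additive_endo: "subgroup_additive VF (endo P)"
proof
  show "endo P (x + y) = endo P x + endo P y" if "x \<in> VF" "y \<in> VF" for x y
    by (rule ext) (use tensor_P that in \<open>simp add: tensor_field_11_def endo_def vector_field_at fun_eq_iff\<close>)
qed (rule VF_diff)

lemma additive_G_left: "subgroup_additive VF (\<lambda>x. G x z)" if "z \<in> VF"
proof
  show "G (x + y) z = G x z + G y z" if "x \<in> VF" "y \<in> VF" for x y
    by (rule ext)
       (use metric that \<open>z \<in> VF\<close> in \<open>simp add: riemannian_metric_def inner_vf_def vector_field_at\<close>)
qed (rule VF_diff)

lemma additive_G_right: "subgroup_additive VF (\<lambda>x. G z x)" if "z \<in> VF"
  by unfold_locales
     (use additive_G_left[OF that] that in
       \<open>auto simp: VF_diff G_sym[OF that] VF_add subgroup_additive_def\<close>)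

lemma additive_D_left: "subgroup_additive VF (\<lambda>x. D x z)"
  and additive_D_right: "subgroup_additive VF (\<lambda>x. D z x)"
  and additive_nabla_right: "subgroup_additive VF (\<lambda>x. nabla z x)" if "z \<in> VF"
  using lc_D lc_nabla that
  by (unfold_locales; auto simp: VF_diff linear_connection_def)+

lemma additive_bracket: "subgroup_additive VF (\<lambda>x. lie_bracket x z)" if "z \<in> VF"
  using lc_nabla that
  by unfold_locales (auto simp: VF_diff VF_add lie_bracket_nabla linear_connection_def algebra_simps)

lemma additive_T_left: "subgroup_additive VF (\<lambda>x. T x z)" if "z \<in> VF"
  using that
  by unfold_locales
     (auto simp: VF_diff torsion_def algebra_simps subgroup_additive.add[OF additive_D_left]
       subgroup_additive.add[OF additive_D_right] subgroup_additive.add[OF additive_bracket])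

lemma additive_T_right: "subgroup_additive VF (\<lambda>x. T z x)" if "z \<in> VF"
proof -
  interpret subgroup_additive VF "\<lambda>x. T x z" using additive_T_left[OF that] .
  show ?thesis
    by unfold_locales (auto simp: VF_diff T_swap[of z] add)
qed

lemma G_definite: "X = 0" if "X \<in> VF" "G X X = 0"
proof
  fix p
  have "g p (X p) (X p) = 0" using fun_cong[OF that(2), of p] by (simp add: inner_vf_def)
  moreover have "X p \<noteq> 0 \<longrightarrow> g p (X p) (X p) > 0"
    using metric vector_field_at[OF that(1)] unfolding riemannian_metric_def by blast
  ultimately show "X p = 0 p" by auto
qed

text \<open>The Boolean stands for the eigenvalue, \<open>True\<close> for \<open>1\<close> and \<open>False\<close> for \<open>-1\<close>, so that \<open>\<not> s\<close> is the opposite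
  eigenbundle and the two eigenbundles are treated by the same proofs.\<close>

definition eigenfield :: "bool \<Rightarrow> 'a vfield \<Rightarrow> bool" where
  "eigenfield s x \<longleftrightarrow> x \<in> VF \<and> endo P x = (if s then x else - x)"

lemma eigen_VF: "eigenfield s x \<Longrightarrow> x \<in> VF"
  by (simp add: eigenfield_def)

lemma eigen_diff: "eigenfield s x \<Longrightarrow> eigenfield s y \<Longrightarrow> eigenfield s (x - y)"
  by (auto simp: eigenfield_def VF_diff subgroup_additive.diff[OF additive_endo])

lemma eigen_minus: "eigenfield s x \<Longrightarrow> eigenfield s (- x)"
  by (auto simp: eigenfield_def VF_minus subgroup_additive.minus[OF additive_endo])

lemma eigen_add: "eigenfield s x \<Longrightarrow> eigenfield s y \<Longrightarrow> eigenfield s (x + y)"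
  using eigen_diff[of s x "- y"] eigen_minus by simp

lemma eigen_both_zero: "x = 0" if "eigenfield s x" "eigenfield (\<not> s) x"
  using that vfield_self_neg_zero[of x] by (cases s) (auto simp: eigenfield_def)

text \<open>Twice the projection of \<open>x\<close> to the eigenbundle \<open>s\<close>.\<close>

lemma eigen_proj: "eigenfield s (x + (if s then endo P x else - endo P x))" if "x \<in> VF"
  using that
  by (auto simp: eigenfield_def VF_add VF_minus VF_diff endo_VF PP
        subgroup_additive.add[OF additive_endo] subgroup_additive.diff[OF additive_endo]
        subgroup_additive.minus[OF additive_endo])

text \<open>The reduction to eigenfields: \<open>f\<close> vanishes at \<open>x + Px\<close> and at \<open>x - Px\<close>, hence at their sum \<open>2x\<close>.\<close>

lemma additive_zero_on_eigen:
  fixes f :: "'a vfield \<Rightarrow> 'a vfield"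
  assumes f: "subgroup_additive VF f" and vanish: "\<And>s x. eigenfield s x \<Longrightarrow> f x = 0" and x: "x \<in> VF"
  shows "f x = 0"
proof -
  interpret subgroup_additive VF f by fact
  have "f (x + endo P x) = 0" "f (x - endo P x) = 0"
    using vanish eigen_proj[OF x, of True] eigen_proj[OF x, of False] by auto
  then have "f x + f (endo P x) = 0" "f x = f (endo P x)"
    using x endo_VF by (simp_all add: add diff)
  then show ?thesis
    by (metis vfield_self_neg_zero add_eq_0_iff)
qed

lemma eigen_D: "eigenfield s (D x y)" if "x \<in> VF" "eigenfield s y"
  using that D_P[of x y]
  by (auto simp: eigenfield_def D_VF subgroup_additive.minus[OF additive_D_right] split: if_splits)

lemma eigen_orthogonal: "G a b = 0" if "eigenfield s a" "eigenfield (\<not> s) b"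
proof (rule fun_self_neg_zero)
  show "G a b = - G a b"
    using that GP[of a b]
    by (cases s) (auto simp: eigenfield_def subgroup_additive.minus[OF additive_G_left]
        subgroup_additive.minus[OF additive_G_right] VF_minus)
qed

text \<open>Twice the projection of \<open>X\<close> to the eigenbundle \<open>s\<close> is orthogonal to itself, because it is orthogonal
  both to \<open>X\<close> and to \<open>PX\<close>.\<close>

lemma eigenI_orthogonal:
  assumes X: "X \<in> VF" and orth: "\<And>a. eigenfield s a \<Longrightarrow> G X a = 0"
  shows "eigenfield (\<not> s) X"
proof -
  define Y where "Y = X + (if s then endo P X else - endo P X)"
  have Y: "eigenfield s Y" using eigen_proj[OF X] by (simp add: Y_def)
  note VF = X eigen_VF[OF Y] endo_VF
  have "G (endo P X) Y = (if s then G X Y else - G X Y)"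
    using GP[OF X VF(2)] Y VF
    by (auto simp: eigenfield_def subgroup_additive.minus[OF additive_G_right] minus_equation_iff split: if_splits)
  then have "G (endo P X) Y = 0" using orth[OF Y] by simp
  moreover have "G Y Y = G X Y + (if s then G (endo P X) Y else - G (endo P X) Y)"
    using VF by (simp add: Y_def[symmetric] subgroup_additive.add[OF additive_G_left, symmetric]
        subgroup_additive.diff[OF additive_G_left, symmetric]) (simp add: Y_def)
  ultimately have "G Y Y = 0" using orth[OF Y] by simp
  then have "Y = 0" using G_definite VF by blast
  then show ?thesis using X by (auto simp: eigenfield_def Y_def add_eq_0_iff split: if_splits)
qed


section \<open>The torsion on eigenfields\<close>

text \<open>For \<open>a\<close> and \<open>b\<close> with the same eigenvalue the two signs produced by \<open>P\<close> cancel, so the second half of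
  the defining condition of the canonical connection repeats the first half.\<close>

lemma T_eigen_symmetric:
  assumes "eigenfield s a" "eigenfield s b" "y \<in> VF"
  shows "G (T a y) b = G (T b y) a"
proof -
  note VF = eigen_VF[OF assms(1)] eigen_VF[OF assms(2)] assms(3)
  note minus = subgroup_additive.minus[OF additive_G_left] subgroup_additive.minus[OF additive_G_right]
    subgroup_additive.minus[OF additive_T_left] subgroup_additive.minus[OF additive_T_right]
  have "G (T (endo P a) y) (endo P b) = G (T a y) b" "G (T y (endo P b)) (endo P a) = G (T y b) a"
    using assms VF by (auto simp: eigenfield_def minus VF_minus T_VF split: if_splits)
  then have "(G (T a y) b + G (T y b) a) = - (G (T a y) b + G (T y b) a)"
    using T_canonical[OF VF(1,3,2)] by (simp add: algebra_simps eq_neg_iff_add_eq_0)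
  then have "G (T a y) b + G (T y b) a = 0" by (rule fun_self_neg_zero)
  moreover have "G (T y b) a = - G (T b y) a"
    using VF by (simp add: T_swap[of y b] minus T_VF)
  ultimately show ?thesis by simp
qed

lemma G_T_swap: "x \<in> VF \<Longrightarrow> y \<in> VF \<Longrightarrow> z \<in> VF \<Longrightarrow> G (T y x) z = - G (T x y) z"
  by (simp add: T_swap[of y x] subgroup_additive.minus[OF additive_G_left] T_VF)

text \<open>On one eigenbundle \<open>T(a,b,c)\<close> is skew in its first two and symmetric in its first and third
  arguments. Applying the two symmetries alternately, three times each, returns to \<open>T(a,b,c)\<close> with
  the opposite sign.\<close>

lemma T_same_eigen_opposite:
  assumes "eigenfield s a" "eigenfield s b"
  shows "eigenfield (\<not> s) (T a b)"
proof (rule eigenI_orthogonal)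
  show "T a b \<in> VF" using assms by (auto intro: T_VF eigen_VF)
  fix c assume c: "eigenfield s c"
  note VF = eigen_VF[OF assms(1)] eigen_VF[OF assms(2)] eigen_VF[OF c]
  have "G (T a b) c = G (T c b) a" using assms c VF by (simp add: T_eigen_symmetric)
  also have "\<dots> = - G (T b c) a" using VF G_T_swap by blast
  also have "\<dots> = - G (T a c) b" using assms c VF T_eigen_symmetric by metis
  also have "\<dots> = G (T c a) b" using VF G_T_swap[of a c b] by simp
  also have "\<dots> = G (T b a) c" using assms c VF T_eigen_symmetric by metis
  also have "\<dots> = - G (T a b) c" using VF G_T_swap by blast
  finally show "G (T a b) c = 0" by (rule fun_self_neg_zero)
qed

lemma nabla_metric':
  "x \<in> VF \<Longrightarrow> y \<in> VF \<Longrightarrow> z \<in> VF \<Longrightarrow> vf_deriv x (G y z) = G (nabla x y) z + G y (nabla x z)"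
  using nabla_metric[of x y z] by (simp add: deriv_metric_def algebra_simps)

lemma D_metric':
  "x \<in> VF \<Longrightarrow> y \<in> VF \<Longrightarrow> z \<in> VF \<Longrightarrow> vf_deriv x (G y z) = G (D x y) z + G y (D x z)"
  using D_metric[of x y z] by (simp add: deriv_metric_def algebra_simps)

text \<open>The derivative of the constant \<open>g(c,a) = 0\<close>.\<close>

lemma nabla_eigen_skew:
  assumes x: "x \<in> VF" and a: "eigenfield s a" and c: "eigenfield (\<not> s) c"
  shows "G (nabla x c) a = - G (nabla x a) c"
proof -
  note VF = x eigen_VF[OF a] eigen_VF[OF c]
  have "G c a = (\<lambda>q. 0)"
    using eigen_orthogonal[OF a c] VF by (simp add: G_sym[of c] zero_fun_def)
  then have "vf_deriv x (G c a) = 0"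
    by (simp add: vf_deriv_def tangent_zero_function[OF vector_field_at[OF x]] zero_fun_def)
  then show ?thesis
    using nabla_metric'[of x c a] VF by (simp add: G_sym[of c] nabla_VF eq_neg_iff_add_eq_0)
qed

text \<open>\<open>F(x,y,z)\<close> vanishes if \<open>y\<close> and \<open>z\<close> are in the same eigenbundle, and it is \<open>\<plusminus>2 g(\<nabla>\<^sub>x y, z)\<close> otherwise. So
  the cyclic sum at \<open>a\<close>, \<open>b\<close>, \<open>c\<close> has at most two nonzero terms.\<close>

lemma nabla_eigen_antisymmetric:
  assumes a: "eigenfield s a" and b: "eigenfield s b" and c: "eigenfield (\<not> s) c"
  shows "G (nabla a b) c + G (nabla b a) c = 0"
proof -
  note VF = eigen_VF[OF a] eigen_VF[OF b] eigen_VF[OF c]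
  note G_add = subgroup_additive.diff[OF additive_G_left] subgroup_additive.minus[OF additive_G_left]
    subgroup_additive.minus[OF additive_G_right] subgroup_additive.minus[OF additive_nabla_right]
  have P: "G (endo P X) y = (if t then G X y else - G X y)" if "X \<in> VF" "eigenfield t y" for X y t
    using GP[OF that(1) eigen_VF[OF that(2)]] that
    by (auto simp: eigenfield_def G_add endo_VF minus_equation_iff split: if_splits)
  have F: "F_tensor P g nabla x y z =
       (if t then G (nabla x y) z else - G (nabla x y) z) - (if u then G (nabla x y) z else - G (nabla x y) z)"
    if "x \<in> VF" "eigenfield t y" "eigenfield u z" for x y z t u
    using that eigen_VF[OF that(2)] eigen_VF[OF that(3)]
    by (auto simp: F_tensor_def deriv_endo_def G_add P nabla_VF endo_VF VF_minus eigenfield_def split: if_splits)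
  have skew: "G (nabla b c) a = - G (nabla b a) c"
    using nabla_eigen_skew[OF VF(2) a c] .
  show ?thesis
  proof
    fix p
    show "(G (nabla a b) c + G (nabla b a) c) p = 0 p"
      using fun_cong[OF F_cyclic[OF VF], of p] fun_cong[OF skew, of p]
      by (cases s) (simp_all add: F[OF VF(1) b c] F[OF VF(2) c a] F[OF VF(3) a b])
  qed
qed

text \<open>The form \<open>(a,b) \<mapsto> T(a,c,b)\<close> is symmetric on the eigenbundle \<open>s\<close>, since the connection is canonical.
  Its symmetrization is half the negative of the Lie derivative of the metric along \<open>c\<close> (restricted
  to that eigenbundle), which is zero on a \<open>W\<^sub>3\<close>-manifold.\<close>

lemma T_mixed_orthogonal:
  assumes a: "eigenfield s a" and b: "eigenfield s b" and c: "eigenfield (\<not> s) c"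
  shows "G (T a c) b = 0"
proof (rule fun_self_neg_zero)
  note VF = eigen_VF[OF a] eigen_VF[OF b] eigen_VF[OF c]
  note G_diff = subgroup_additive.diff[OF additive_G_left]
  \<comment> \<open>The term \<open>D\<^sub>x c\<close> of the torsion drops out, as it stays in the eigenbundle of \<open>c\<close>.\<close>
  have half: "G (T x c) y = G (nabla c x) y - G (D c x) y + G (nabla x y) c"
    if x: "eigenfield s x" and y: "eigenfield s y" for x y
  proof -
    note VF' = eigen_VF[OF x] eigen_VF[OF y]
    have "G (D x c) y = 0"
      using eigen_orthogonal[of "\<not> s" "D x c" y] eigen_D[OF VF'(1) c] y by simp
    moreover have "G (nabla x c) y = - G (nabla x y) c"
      using nabla_eigen_skew[OF VF'(1) y c] .
    ultimately show ?thesis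
      using VF VF' by (simp add: torsion_def lie_bracket_nabla G_diff D_VF nabla_VF VF_diff)
  qed
  \<comment> \<open>Both connections are metric, so both sides are the derivative of \<open>g(a,b)\<close> along \<open>c\<close>.\<close>
  have parallel: "G (nabla c a) b + G (nabla c b) a = G (D c a) b + G (D c b) a"
    using nabla_metric'[of c a b] D_metric'[of c a b] VF by (simp add: G_sym[of a] nabla_VF D_VF)
  have "G (T a c) b + G (T b c) a
      = (G (nabla c a) b + G (nabla c b) a) - (G (D c a) b + G (D c b) a)
        + (G (nabla a b) c + G (nabla b a) c)"
    by (simp add: half[OF a b] half[OF b a] algebra_simps)
  then have "G (T a c) b + G (T b c) a = 0"
    using parallel nabla_eigen_antisymmetric[OF a b c] by simp
  then show "G (T a c) b = - G (T a c) b"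
    using T_eigen_symmetric[OF a b VF(3)] by (simp add: eq_neg_iff_add_eq_0)
qed

lemma T_mixed_eigen_zero:
  assumes a: "eigenfield s a" and c: "eigenfield (\<not> s) c"
  shows "T a c = 0"
proof (rule eigen_both_zero)
  note VF = eigen_VF[OF a] eigen_VF[OF c]
  show "eigenfield (\<not> s) (T a c)"
    using T_mixed_orthogonal[OF a _ c] VF by (intro eigenI_orthogonal T_VF)
  have "G (T a c) y = 0" if "eigenfield (\<not> s) y" for y
    using T_mixed_orthogonal[of "\<not> s" c y a] a c that VF G_T_swap[of c a y] eigen_VF[OF that]
    by simp
  then show "eigenfield (\<not> \<not> s) (T a c)"
    using VF by (intro eigenI_orthogonal T_VF)
qed


section \<open>The first Bianchi identity\<close>

text \<open>The second covariant derivatives are grouped as \<open>D\<^sub>x(D\<^sub>y z - D\<^sub>z y)\<close>, and each such difference is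
  \<open>T(y,z) + [y,z]\<close>; the iterated brackets that remain cancel by the Jacobi identity.\<close>

lemma first_bianchi:
  assumes "x \<in> VF" "y \<in> VF" "z \<in> VF"
  shows "curvature D x y z + curvature D y z x + curvature D z x y =
     D x (T y z) + D y (T z x) + D z (T x y)
     + T x (lie_bracket y z) + T y (lie_bracket z x) + T z (lie_bracket x y)"
proof -
  have T: "D u (T v w) = D u (D v w) - D u (D w v) - D u (lie_bracket v w)"
    if "u \<in> VF" "v \<in> VF" "w \<in> VF" for u v w
    using that by (simp add: torsion_def subgroup_additive.diff[OF additive_D_right] D_VF VF_diff lie_bracket_VF)
  have "curvature D x y z + curvature D y z x + curvature D z x y =
     D x (T y z) + D y (T z x) + D z (T x y)
     + T x (lie_bracket y z) + T y (lie_bracket z x) + T z (lie_bracket x y)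
     + (lie_bracket x (lie_bracket y z) + lie_bracket y (lie_bracket z x)
        + lie_bracket z (lie_bracket x y))"
    unfolding T[OF assms(1,2,3)] T[OF assms(2,3,1)] T[OF assms(3,1,2)]
    by (simp add: curvature_def torsion_def algebra_simps)
  then show ?thesis
    by (simp only: lie_bracket_jacobi[OF atlas assms] add_0_right)
qed

text \<open>On mixed pairs \<open>T\<close> is zero, hence \<open>[b,c] = D\<^sub>b c - D\<^sub>c b\<close> and \<open>[c,a] = D\<^sub>c a - D\<^sub>a c\<close>. So the cyclic identity shrinks to
  \<open>D\<^sub>c(T(a,b)) - T(a, D\<^sub>c b) + T(b, D\<^sub>c a) + T(T(a,b),c) = 0\<close>. The first three terms have the type of \<open>c\<close>
  and the last one has the type of \<open>a\<close>, so the last one is zero.\<close>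

lemma torsion_of_torsion_eigen:
  assumes cyc: "\<And>x y z. x \<in> VF \<Longrightarrow> y \<in> VF \<Longrightarrow> z \<in> VF \<Longrightarrow>
      curvature D x y z + curvature D y z x + curvature D z x y = 0"
    and a: "eigenfield s a" and b: "eigenfield s b" and c: "eigenfield (\<not> s) c"
  shows "T (T a b) c = 0"
proof -
  note VF = eigen_VF[OF a] eigen_VF[OF b] eigen_VF[OF c]
  note T_diff = subgroup_additive.diff[OF additive_T_right]
  have br: "lie_bracket u v = D u v - D v u - T u v" for u v
    by (simp add: torsion_def)
  have T0: "T b c = 0" "T c a = 0"
    using T_mixed_eigen_zero[OF b c] T_mixed_eigen_zero[OF a c] T_swap[of c a] by simp_all
  have D0: "D a 0 = 0" "D b 0 = 0"
    using subgroup_additive.zero[OF additive_D_right VF_zero] VF by auto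
  have Ta: "T a (lie_bracket b c) = - T a (D c b)"
    using VF T_mixed_eigen_zero[OF a eigen_D[OF VF(2) c]] by (simp add: br T0 T_diff D_VF)
  have Tb: "T b (lie_bracket c a) = T b (D c a)"
    using VF T_mixed_eigen_zero[OF b eigen_D[OF VF(1) c]] by (simp add: br T0 T_diff D_VF)
  have cD: "T c (D u v) = 0" if "u \<in> VF" "eigenfield s v" for u v
    using T_mixed_eigen_zero[OF eigen_D[OF that] c] T_swap[of c "D u v"] by simp
  have Tc: "T c (lie_bracket a b) = T (T a b) c"
    using VF a b by (simp add: br T_diff cD D_VF VF_diff T_VF T_swap[of c "T a b"])
  have "D c (T a b) - T a (D c b) + T b (D c a) + T (T a b) c = 0"
    using first_bianchi[OF VF] cyc[OF VF] by (simp add: T0 D0 Ta Tb Tc)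
  then have eq: "T (T a b) c = - (D c (T a b) - T a (D c b) + T b (D c a))"
    by (metis add.commute eq_neg_iff_add_eq_0)
  show ?thesis
  proof (rule eigen_both_zero)
    show "eigenfield (\<not> s) (T (T a b) c)"
      unfolding eq using VF a b
      by (intro eigen_minus eigen_add eigen_diff eigen_D T_same_eigen_opposite) auto
    show "eigenfield (\<not> \<not> s) (T (T a b) c)"
      using T_same_eigen_opposite[of "\<not> s" "T a b" c] T_same_eigen_opposite[OF a b] c by simp
  qed
qed

lemma torsion_of_torsion_zero:
  assumes cyc: "\<And>x y z. x \<in> VF \<Longrightarrow> y \<in> VF \<Longrightarrow> z \<in> VF \<Longrightarrow>
      curvature D x y z + curvature D y z x + curvature D z x y = 0"
    and x: "x \<in> VF" and y: "y \<in> VF" and z: "z \<in> VF"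
  shows "T (T x y) z = 0"
proof -
  have add: "subgroup_additive VF (\<lambda>x. T (T x y) z)" "subgroup_additive VF (\<lambda>y. T (T x y) z)"
    if "x \<in> VF" "y \<in> VF" "z \<in> VF" for x y z
    using that
    by (unfold_locales; simp add: VF_diff T_VF subgroup_additive.add[OF additive_T_left]
        subgroup_additive.add[OF additive_T_right])+
  have eigen: "T (T a b) c = 0" if a: "eigenfield s a" and b: "eigenfield t b" and c: "eigenfield u c"
    for a b c s t u
  proof (cases "s = t")
    case True
    with b have b': "eigenfield s b" by simp
    show ?thesis
    proof (cases "u = s")
      case True
      with c have "eigenfield (\<not> \<not> s) c" by simp
      then show ?thesis by (rule T_mixed_eigen_zero[OF T_same_eigen_opposite[OF a b']])
    next
      case False
      then have "u = (\<not> s)" by blast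
      with c have "eigenfield (\<not> s) c" by simp
      with cyc a b' show ?thesis by (rule torsion_of_torsion_eigen)
    qed
  next
    case False
    then have "t = (\<not> s)" by blast
    with b have "T a b = 0" using T_mixed_eigen_zero[OF a] by simp
    then show ?thesis
      using subgroup_additive.zero[OF additive_T_left VF_zero] eigen_VF[OF c] by simp
  qed
  have right: "T (T a b) z = 0" if a: "eigenfield s a" and b: "eigenfield t b" for a b s t
    by (rule additive_zero_on_eigen[OF additive_T_right[OF T_VF[OF eigen_VF[OF a] eigen_VF[OF b]]]
          eigen[OF a b] z])
  have middle: "T (T a y) z = 0" if a: "eigenfield s a" for a s
    by (rule additive_zero_on_eigen[OF add(2)[OF eigen_VF[OF a] y z] right[OF a] y])
  show ?thesis
    by (rule additive_zero_on_eigen[OF add(1)[OF x y z] middle x])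
qed

text \<open>The hypothesis speaks of the \<open>(0,4)\<close>-tensor; definiteness of the metric removes the last argument.\<close>

lemma cyclic_curvature:
  assumes L: "riemannian_P_tensor A P (curvature4 g D)" and "x \<in> VF" "y \<in> VF" "z \<in> VF"
  shows "curvature D x y z + curvature D y z x + curvature D z x y = 0"
proof (rule G_definite)
  have C: "curvature D u v w \<in> VF" if "u \<in> VF" "v \<in> VF" "w \<in> VF" for u v w
    using that by (simp add: curvature_def VF_diff D_VF lie_bracket_VF)
  let ?S = "curvature D x y z + curvature D y z x + curvature D z x y"
  show S: "?S \<in> VF" using assms C by (simp add: VF_add)
  have "G ?S w = curvature4 g D x y z w + curvature4 g D y z x w + curvature4 g D z x y w" if "w \<in> VF" for w
    using that assms C by (simp add: curvature4_def subgroup_additive.add[OF additive_G_left] VF_add)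
  moreover have "curvature4 g D x y z w + curvature4 g D y z x w + curvature4 g D z x y w = 0"
    if "w \<in> VF" for w
    using L assms(2-4) that unfolding riemannian_P_tensor_def by blast
  ultimately show "G ?S ?S = 0" using S by simp
qed

end

theorem proposition5p1:
  fixes A :: "('a::{t2_space, second_countable_topology}, 'e::euclidean_space) atlas"
    and P :: "'a endo_field"
    and g :: "'a bilin_field"
    and nabla nabla' :: "'a connection"
  assumes "W3_manifold A P g nabla"
    and "canonical_connection A P g nabla'"
    and "riemannian_P_tensor A P (curvature4 g nabla')"
  shows "\<forall>x\<in>vector_fields A. \<forall>y\<in>vector_fields A. \<forall>z\<in>vector_fields A. \<forall>w\<in>vector_fields A.
           torsion3 g nabla' (torsion nabla' x y) z w = 0"
proof -
  interpret canonical_W3 A P g nabla nabla'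
    using assms by unfold_locales
  have "torsion3 g nabla' (T x y) z w = 0" if "x \<in> VF" "y \<in> VF" "z \<in> VF" "w \<in> VF" for x y z w
    using that torsion_of_torsion_zero[OF cyclic_curvature[OF assms(3)]]
      subgroup_additive.zero[OF additive_G_left VF_zero, of w]
    by (simp add: torsion3_def)
  then show ?thesis by blast
qed

end
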